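(* Fix a quantile level $\tau\in(0,1)$. For each sample size $n$ let $Y_1,\dots,Y_n$ follow the piecewise constant model with $K^*\in\mathbb{N}$ change-points $1<t_1^*<\dots<t_{K^*}^*<n$, phase values $\mu_1^*,\dots,\mu_{K^*+1}^*$ satisfying $\mu_k^*\neq\mu_{k+1}^*$ for $k=1,\dots,K^*$, and errors $\varepsilon_t$, and let $\widehat{\mathcal A}_n=\{\widehat t_1<\dots<\widehat t_{|\widehat{\mathcal A}_n|}\}$ be the set of change-point locations estimated by the quantile LASSO with regularization parameter $\lambda_n>0$ (model and estimator as defined in the context). Assume: (i) the values $\mu_k^*\in\mathbb{R}$, $k=1,\dots,K^*+1$, do not depend on $n$; (ii) the errors $\varepsilon_i$ are i.i.d. with an absolutely continuous distribution function $F$ such that $\mathbb{P}[\varepsilon_i<0]=\tau$, whose density $f$ satisfies $f(x)>0$ for all $x\in\mathbb{R}$ and is continuously differentiable with $|f'(x)|<\infty$; (iii) $I_{\min}^*:=\min_{1\le k\le K^*}(t_{k+1}^*-t_k^* )\ge n\delta_n$ for a decreasing positive sequence $(\delta_n)$ with $\delta_n\to0$ as $n\to\infty$; (iv) $\lambda_n/\delta_n\to0$ as $n\to\infty$; (v) $K^*$ is fixed and does not depend on $n$; (vi) $\lambda_n=C(n^{-1}\log n)^{1/2}$ for some constant $C>0$; (vii) $t_k^*/n\to\tau_k^*$ as $n\to\infty$ for $k=1,\dots,K^*$, where $0<\tau_1^*<\dots<\tau_{K^*}^*<1$ are fixed. Let $\mathcal T^*=\{t_1^*,\dots,t_{K^*}^*\}$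 and $\widehat{\mathcal T}_{|\widehat{\mathcal A}_n|}=\{\widehat t_1,\dots,\widehat t_{|\widehat{\mathcal A}_n|}\}$. Suppose that $|\widehat{\mathcal A}_n|\ge K^*$. Then $$\mathbb{P}\Big[\mathcal E\big(\widehat{\mathcal T}_{|\widehat{\mathcal A}_n|}\,\|\,\mathcal T^*\big)\le n\delta_n\Big]\to1\qquad\text{as } n\to\infty,$$ where $\mathcal E(A\|B)=\sup_{b\in B}\inf_{a\in A}|a-b|$.
   Context: Model. With the conventions $t_0^*=1$ and $t_{K^*+1}^*=n+1$, the observations are $Y_t=\mu_k^*+\varepsilon_t$ for $t_{k-1}^*\le t\le t_k^*-1$, $k=1,\dots,K^*+1$ (so $t=1,\dots,n$). The change-point locations $t_k^*$ may depend on $n$. Estimator. Let $\rho_\tau(v)=v\,(\tau-\mathbf{1}\{v<0\})$ for $v\in\mathbb{R}$. Let $\mathbb{X}_n$ be the $n\times n$ lower triangular matrix whose entries on and below the diagonal are all equal to $1$ (and $0$ above), so that $(\mathbb{X}_n\beta)_i=\sum_{j=1}^i\beta_j$. The quantile LASSO estimator is a solution $$\widehat{\beta}^n=(\widehat\beta_1,\dots,\widehat\beta_n)^\top\in\operatorname*{arg\,min}_{\beta\in\mathbb{R}^n}\Big[\sum_{i=1}^n\rho_\tau\big(Y_i-(\mathbb{X}_n\beta)_i\big)+n\lambda_n\sum_{i=2}^n|\beta_i|\Big].$$ The set of estimated change-point locations is $\widehat{\mathcal A}_n=\{i\in\{2,\dots,n\}:\widehat\beta_i\neq0\}=\{\widehat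 t_1,\dots,\widehat t_{|\widehat{\mathcal A}_n|}\}$, with $\widehat t_1<\dots<\widehat t_{|\widehat{\mathcal A}_n|}$. *)

theory Defs
  imports "HOL-Probability.Probability"
begin

definition check_loss :: "real \<Rightarrow> real \<Rightarrow> real" where
  "check_loss \<tau> v = v * (\<tau> - of_bool (v < 0))"

(* Vectors in R^n are extensional functions on {1..n}, i.e. elements of {1..n} \<rightarrow>\<^sub>E UNIV. *)

definition design_mat :: "nat \<Rightarrow> nat \<Rightarrow> real" where
  "design_mat i j = (if j \<le> i then 1 else 0)"

definition design_mult :: "nat \<Rightarrow> (nat \<Rightarrow> real) \<Rightarrow> nat \<Rightarrow> real" where
  "design_mult n b i = (\<Sum>j=1..n. design_mat i j * b j)"

definition qlasso_objective ::
    "real \<Rightarrow> nat \<Rightarrow> real \<Rightarrow> (nat \<Rightarrow> real) \<Rightarrow> (nat \<Rightarrow> real) \<Rightarrow> real" where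
  "qlasso_objective \<tau> n lam y b =
     (\<Sum>i=1..n. check_loss \<tau> (y i - design_mult n b i)) + real n * lam * (\<Sum>i=2..n. \<bar>b i\<bar>)"

(* The minimiser need not be unique; this says that b is one of them. *)
definition is_qlasso ::
    "real \<Rightarrow> nat \<Rightarrow> real \<Rightarrow> (nat \<Rightarrow> real) \<Rightarrow> (nat \<Rightarrow> real) \<Rightarrow> bool" where
  "is_qlasso \<tau> n lam y b \<longleftrightarrow>
     is_arg_min (qlasso_objective \<tau> n lam y) (\<lambda>c. c \<in> {1..n} \<rightarrow>\<^sub>E UNIV) b"

definition estimated_cps :: "nat \<Rightarrow> (nat \<Rightarrow> real) \<Rightarrow> nat set" where
  "estimated_cps n b = {i \<in> {2..n}. b i \<noteq> 0}"

(* The change-points are t 1 < ... < t K (with K \<ge> 1); t 0 and t (K + 1) carry the boundary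
   conventions. *)
definition change_points :: "nat \<Rightarrow> nat \<Rightarrow> (nat \<Rightarrow> nat) \<Rightarrow> bool" where
  "change_points n K t \<longleftrightarrow>
     t 0 = 1 \<and> t (K + 1) = n + 1 \<and> 1 < t 1 \<and> strict_mono_on {1..K} t \<and> t K < n"

definition piecewise_constant_model ::
    "nat \<Rightarrow> (nat \<Rightarrow> nat) \<Rightarrow> (nat \<Rightarrow> real) \<Rightarrow> (nat \<Rightarrow> real) \<Rightarrow> (nat \<Rightarrow> real) \<Rightarrow> bool" where
  "piecewise_constant_model K t \<mu> e y \<longleftrightarrow>
     (\<forall>k\<in>{1..K + 1}. \<forall>i\<in>{t (k - 1)..t k - 1}. y i = \<mu> k + e i)"

(* The gap t 1 - t 0 does not enter, whereas t (K + 1) - t K = n + 1 - t K does. *)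
definition min_gap :: "nat \<Rightarrow> (nat \<Rightarrow> nat) \<Rightarrow> real" where
  "min_gap K t = Min ((\<lambda>k. real (t (k + 1)) - real (t k)) ` {1..K})"

(* Extended reals, so that the value for A = {} and B \<noteq> {} is \<infinity>. *)
definition one_sided_dist :: "nat set \<Rightarrow> nat set \<Rightarrow> ereal" where
  "one_sided_dist A B = (SUP b\<in>B. INF a\<in>A. ereal \<bar>real a - real b\<bar>)"

end

theory Submission
  imports Defs "HOL-Real_Asymp.Real_Asymp"
begin

text \<open>
  Suppose some true change-point \<open>p\<close> has no estimated change-point within distance \<open>n \<delta>\<^sub>n\<close>, and let
  \<open>m\<close> be the integer part of \<open>n \<delta>\<^sub>n\<close>.  The fitted signal is then a constant \<open>c\<close> on the \<open>m\<close>
  observations before \<open>p\<close> and the \<open>m\<close> observations from \<open>p\<close> on, although the true signal jumps at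
  \<open>p\<close>.  On one of these two blocks \<open>c\<close> is therefore wrong by at least half the jump, hence by at
  least \<open>2 d\<close>, where \<open>4 d\<close> is the smallest jump (lemma \<open>missed_jump\<close>).

  The fit is a minimiser, so moving it by \<open>d\<close> towards the true level on this block alone cannot
  improve the objective.  Such a move creates at most two new jumps of size \<open>d\<close>, costing
  \<open>2 n \<lambda>\<^sub>n d\<close>, while by convexity of the check loss the gain is at least \<open>d\<close> times the surplus, over
  its share \<open>\<tau>\<close>, of the observations of the block that lie below the moved fit, or of the mirror
  image of this surplus (\<open>qlasso_block_score\<close>).  If \<open>c\<close> is too large, every error below \<open>d\<close> is such
  an observation (\<open>badly_fitted_block\<close>).  So on a block that is fixed in advance the number of
  errors in \<open>(-\<infinity>, d)\<close> is at most \<open>m \<tau> + 2 n \<lambda>\<^sub>n\<close>, or the number of errors in \<open>[-d, \<infinity>)\<close> is at most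
  \<open>m (1 - \<tau>) + 2 n \<lambda>\<^sub>n\<close>.

  This is improbable.  The density is positive, so these two half-lines have probabilities that
  exceed \<open>\<tau>\<close> and \<open>1 - \<tau>\<close> by some \<open>2 \<gamma> > 0\<close> (\<open>quantile_margin\<close>).  As \<open>\<lambda>\<^sub>n = o(\<delta>\<^sub>n)\<close>, the penalty
  \<open>2 n \<lambda>\<^sub>n\<close> is eventually below \<open>\<gamma> m\<close>, and as \<open>n \<lambda>\<^sub>n\<close> is of order \<open>sqrt (n ln n)\<close>, the block length
  \<open>m\<close> tends to infinity (\<open>penalty_below_gap\<close>).  Hoeffding's inequality bounds the probability of
  each exceptional event by \<open>exp (- 2 \<gamma>\<^sup>2 m)\<close>.  The blocks and the half-lines are deterministic and
  there are at most \<open>4 K\<close> combinations of them, so a union bound concludes the proof.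
\<close>

section \<open>Optimality of the fit under block shifts\<close>

lemma check_loss_subgradient:
  "check_loss \<tau> w + (v - w) * (\<tau> - of_bool (w < 0)) \<le> check_loss \<tau> v"
  by (auto simp: check_loss_def algebra_simps)

lemma design_mult_eq_sum:
  assumes "i \<le> n"
  shows "design_mult n b i = (\<Sum>j=1..i. b j)"
proof -
  have "design_mult n b i = (\<Sum>j\<in>{1..n}. if j \<in> {1..i} then b j else 0)"
    unfolding design_mult_def design_mat_def by (intro sum.cong) auto
  also have "\<dots> = (\<Sum>j\<in>{1..n} \<inter> {1..i}. b j)"
    by (rule sum.inter_restrict[symmetric]) simp
  also have "{1..n} \<inter> {1..i} = {1..i}" using assms by auto
  finally show ?thesis .
qed

lemma design_mult_constant:
  assumes "i \<in> {l..r}" "r \<le> n" "\<And>j. j \<in> {l<..r} \<Longrightarrow> b j = 0"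
  shows "design_mult n b i = design_mult n b l"
proof -
  have "(\<Sum>j=1..i. b j) = (\<Sum>j=1..l. b j)"
    using assms by (intro sum.mono_neutral_right) auto
  thus ?thesis using assms by (simp add: design_mult_eq_sum)
qed

text \<open>
  The directional optimality condition of the fit for raising it by \<open>s\<close> on the block \<open>{l..r}\<close> and
  leaving it unchanged elsewhere.  In terms of the coefficients this adds \<open>s\<close> at \<open>l\<close> and subtracts
  it at \<open>r + 1\<close> (when \<open>r < n\<close>), so the total variation grows by at most \<open>2 \<bar>s\<bar>\<close>.  The loss is bounded
  through its subgradient at the shifted fit, which makes the condition valid for shifts that are
  not infinitesimal.
\<close>

lemma qlasso_block_score:
  fixes y b :: "nat \<Rightarrow> real"
  assumes opt: "is_qlasso \<tau> n lam y b" and lam: "lam \<ge> 0"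
    and block: "1 \<le> l" "l \<le> r" "r \<le> n"
  shows "s * (\<Sum>i=l..r. \<tau> - of_bool (y i < design_mult n b i + s)) \<le> 2 * real n * lam * \<bar>s\<bar>"
proof -
  let ?u = "design_mult n b"
  define jump where "jump j = (of_bool (j = l) - of_bool (j = r + 1)) * s" for j
  define c where "c j = (if j \<in> {1..n} then b j + jump j else undefined)" for j
  have jump_sum: "(\<Sum>j=1..i. jump j) = of_bool (i \<in> {l..r}) * s" for i
    using block by (simp add: jump_def sum_subtractf flip: sum_distrib_right)
      (auto simp: of_bool_def)
  have shifted: "design_mult n c i = ?u i + of_bool (i \<in> {l..r}) * s" if "i \<le> n" for i
  proof -
    have "(\<Sum>j=1..i. c j) = (\<Sum>j=1..i. b j + jump j)"
      using that by (intro sum.cong) (auto simp: c_def)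
    thus ?thesis using that by (simp add: design_mult_eq_sum sum.distrib jump_sum del: One_nat_def)
  qed
  have "c \<in> {1..n} \<rightarrow>\<^sub>E UNIV"
    by (rule PiE_I) (auto simp: c_def)
  hence "\<not> qlasso_objective \<tau> n lam y c < qlasso_objective \<tau> n lam y b"
    using opt by (simp add: is_qlasso_def is_arg_min_def)
  hence "(\<Sum>i=1..n. check_loss \<tau> (y i - ?u i)) + real n * lam * (\<Sum>i=2..n. \<bar>b i\<bar>)
      \<le> (\<Sum>i=1..n. check_loss \<tau> (y i - design_mult n c i)) + real n * lam * (\<Sum>i=2..n. \<bar>c i\<bar>)"
    by (simp add: qlasso_objective_def)
  moreover have "(\<Sum>i=1..n. check_loss \<tau> (y i - design_mult n c i))
      \<le> (\<Sum>i=1..n. check_loss \<tau> (y i - ?u i))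
           - (\<Sum>i=1..n. of_bool (i \<in> {l..r}) * (s * (\<tau> - of_bool (y i < ?u i + s))))"
    unfolding sum_subtractf[symmetric]
  proof (rule sum_mono)
    fix i assume "i \<in> {1..n}"
    with check_loss_subgradient[of \<tau> "y i - ?u i - s" "y i - ?u i"]
    show "check_loss \<tau> (y i - design_mult n c i) \<le> check_loss \<tau> (y i - ?u i)
           - of_bool (i \<in> {l..r}) * (s * (\<tau> - of_bool (y i < ?u i + s)))"
      by (cases "i \<in> {l..r}") (simp_all add: shifted diff_less_eq diff_diff_eq)
  qed
  moreover have "(\<Sum>i=1..n. of_bool (i \<in> {l..r}) * (s * (\<tau> - of_bool (y i < ?u i + s))))
      = s * (\<Sum>i=l..r. \<tau> - of_bool (y i < ?u i + s))"
  proof -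
    have "(\<Sum>i=1..n. of_bool (i \<in> {l..r}) * (s * (\<tau> - of_bool (y i < ?u i + s))))
        = (\<Sum>i=l..r. of_bool (i \<in> {l..r}) * (s * (\<tau> - of_bool (y i < ?u i + s))))"
      using block by (intro sum.mono_neutral_right) auto
    thus ?thesis by (simp add: sum_distrib_left)
  qed
  moreover have "(\<Sum>i=2..n. \<bar>c i\<bar>) \<le> (\<Sum>i=2..n. \<bar>b i\<bar>) + 2 * \<bar>s\<bar>"
  proof -
    have "(\<Sum>i=2..n. \<bar>c i\<bar>) \<le> (\<Sum>i=2..n. \<bar>b i\<bar> + (of_bool (i = l) + of_bool (i = r + 1)) * \<bar>s\<bar>)"
      by (intro sum_mono) (auto simp: c_def jump_def)
    also have "\<dots> = (\<Sum>i=2..n. \<bar>b i\<bar>)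
        + ((\<Sum>i=2..n. of_bool (i = l)) + (\<Sum>i=2..n. of_bool (i = r + 1))) * \<bar>s\<bar>"
      by (simp only: sum.distrib flip: sum_distrib_right)
    also have "\<dots> \<le> (\<Sum>i=2..n. \<bar>b i\<bar>) + (1 + 1) * \<bar>s\<bar>"
      by (intro add_mono mult_right_mono order.refl) (simp_all add: of_bool_def)
    finally show ?thesis by simp
  qed
  hence "real n * lam * (\<Sum>i=2..n. \<bar>c i\<bar>) \<le> real n * lam * ((\<Sum>i=2..n. \<bar>b i\<bar>) + 2 * \<bar>s\<bar>)"
    using lam by (intro mult_left_mono) auto
  hence "real n * lam * (\<Sum>i=2..n. \<bar>c i\<bar>)
      \<le> real n * lam * (\<Sum>i=2..n. \<bar>b i\<bar>) + 2 * real n * lam * \<bar>s\<bar>"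
    by (simp add: distrib_left)
  ultimately show ?thesis by linarith
qed

text \<open>
  The shift goes from \<open>c\<close> towards \<open>\<nu>\<close> by \<open>d\<close>, only half of the guaranteed error \<open>2 d\<close>.  The shifted
  fit still lies on the same side of \<open>\<nu>\<close> at distance at least \<open>d\<close>, so the random level \<open>c\<close> can be
  replaced by the deterministic thresholds \<open>d\<close> and \<open>-d\<close> for the errors.
\<close>

lemma badly_fitted_block:
  fixes y e b :: "nat \<Rightarrow> real"
  assumes opt: "is_qlasso \<tau> n lam y b" and lam: "lam \<ge> 0" and d: "d > 0"
    and block: "1 \<le> l" "l \<le> r" "r \<le> n"
    and y: "\<And>i. i \<in> {l..r} \<Longrightarrow> y i = \<nu> + e i"
    and fit: "\<And>i. i \<in> {l..r} \<Longrightarrow> design_mult n b i = c"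
    and far: "2 * d \<le> \<bar>c - \<nu>\<bar>"
  shows "(\<Sum>i=l..r. of_bool (e i \<in> {..<d}) - \<tau>) \<le> 2 * real n * lam
       \<or> (\<Sum>i=l..r. of_bool (e i \<in> {-d..}) - (1 - \<tau>)) \<le> 2 * real n * lam"
proof (cases "c \<ge> \<nu>")
  case True
  have "(-d) * (\<Sum>i=l..r. \<tau> - of_bool (y i < design_mult n b i + (-d))) \<le> 2 * real n * lam * \<bar>-d\<bar>"
    by (rule qlasso_block_score[OF opt lam block])
  hence "d * (\<Sum>i=l..r. of_bool (y i < design_mult n b i - d) - \<tau>) \<le> d * (2 * real n * lam)"
    using d by (simp add: sum_subtractf algebra_simps)
  hence "(\<Sum>i=l..r. of_bool (y i < design_mult n b i - d) - \<tau>) \<le> 2 * real n * lam"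
    using d by (simp only: mult_le_cancel_left_pos)
  moreover have "(\<Sum>i=l..r. of_bool (e i \<in> {..<d}) - \<tau>)
      \<le> (\<Sum>i=l..r. of_bool (y i < design_mult n b i - d) - \<tau>)"
    using True far by (intro sum_mono) (auto simp: y fit)
  ultimately show ?thesis by simp
next
  case False
  have "d * (\<Sum>i=l..r. \<tau> - of_bool (y i < design_mult n b i + d)) \<le> 2 * real n * lam * \<bar>d\<bar>"
    by (rule qlasso_block_score[OF opt lam block])
  hence "d * (\<Sum>i=l..r. \<tau> - of_bool (y i < design_mult n b i + d)) \<le> d * (2 * real n * lam)"
    using d by (simp add: algebra_simps)
  hence "(\<Sum>i=l..r. \<tau> - of_bool (y i < design_mult n b i + d)) \<le> 2 * real n * lam"
    using d by (simp only: mult_le_cancel_left_pos)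
  moreover have "(\<Sum>i=l..r. of_bool (e i \<in> {-d..}) - (1 - \<tau>))
      \<le> (\<Sum>i=l..r. \<tau> - of_bool (y i < design_mult n b i + d))"
    using False far by (intro sum_mono) (auto simp: y fit)
  ultimately show ?thesis by simp
qed

section \<open>Counts of independent errors\<close>

lemma (in prob_space) count_lower_deviation:
  fixes e :: "'i \<Rightarrow> 'a \<Rightarrow> real"
  assumes indep: "indep_vars (\<lambda>_. borel) e I" and I: "finite I" "I \<noteq> {}"
    and A: "A \<in> sets borel"
    and p: "\<And>i. i \<in> I \<Longrightarrow> prob {\<omega> \<in> space M. e i \<omega> \<in> A} = p"
    and "\<gamma> \<ge> 0"
  shows "prob {\<omega> \<in> space M. (\<Sum>i\<in>I. of_bool (e i \<omega> \<in> A)) \<le> real (card I) * (p - \<gamma>)}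
       \<le> exp (- 2 * \<gamma>\<^sup>2 * real (card I))"
proof -
  define X where "X i \<omega> = (indicator A (e i \<omega>) :: real)" for i \<omega>
  have e[measurable]: "e i \<in> borel_measurable M" if "i \<in> I" for i
    using indep that unfolding indep_vars_def by blast
  interpret Hoeffding_ineq M I X "\<lambda>_. 0" "\<lambda>_. 1" "\<Sum>i\<in>I. expectation (X i)"
  proof unfold_locales
    show "indep_vars (\<lambda>_. borel) X I"
      unfolding X_def using A by (intro indep_vars_compose2[OF indep]) auto
  qed (use I in \<open>auto simp: X_def indicator_def\<close>)
  have mean: "expectation (X i) = p" if "i \<in> I" for i
  proof -
    have "expectation (X i) = expectation (indicator {\<omega> \<in> space M. e i \<omega> \<in> A})"
      by (intro Bochner_Integration.integral_cong) (auto simp: X_def indicator_def)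
    also have "\<dots> = p" using that A p by simp
    finally show ?thesis .
  qed
  have card: "card I > 0" using I by (simp add: card_gt_0_iff)
  have "prob {\<omega> \<in> space M. (\<Sum>i\<in>I. X i \<omega>) \<le> (\<Sum>i\<in>I. expectation (X i)) - real (card I) * \<gamma>}
      \<le> exp (-2 * (real (card I) * \<gamma>)\<^sup>2 / (\<Sum>i\<in>I. (1 - 0)\<^sup>2))"
    by (rule Hoeffding_ineq_le) (use card \<open>\<gamma> \<ge> 0\<close> in auto)
  also have "-2 * (real (card I) * \<gamma>)\<^sup>2 / (\<Sum>i\<in>I. (1 - 0)\<^sup>2) = - 2 * \<gamma>\<^sup>2 * real (card I)"
    using card by (simp add: power2_eq_square)
  also have "(\<Sum>i\<in>I. expectation (X i)) - real (card I) * \<gamma> = real (card I) * (p - \<gamma>)"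
    by (simp add: mean algebra_simps)
  also have "(\<lambda>\<omega>. \<Sum>i\<in>I. X i \<omega>) = (\<lambda>\<omega>. \<Sum>i\<in>I. of_bool (e i \<omega> \<in> A))"
    by (simp add: X_def indicator_def of_bool_def)
  finally show ?thesis by simp
qed

section \<open>Consequences of an undetected change-point\<close>

text \<open>
  A constant \<open>c\<close> cannot be close to both \<open>\<nu>\<close> and \<open>\<nu>'\<close>, so one of the two blocks adjacent to \<open>p\<close> is
  badly fitted.  The coefficient at \<open>p - m\<close> is unrestricted: a jump there only fixes the level with
  which the left block starts.
\<close>

lemma missed_jump:
  fixes y e b :: "nat \<Rightarrow> real"
  assumes opt: "is_qlasso \<tau> n lam y b" and lam: "lam \<ge> 0" and d: "d > 0"
    and m: "1 \<le> m" "m < p" "p + m \<le> n + 1"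
    and left: "\<And>i. i \<in> {p - m..p - 1} \<Longrightarrow> y i = \<nu> + e i"
    and right: "\<And>i. i \<in> {p..p + m - 1} \<Longrightarrow> y i = \<nu>' + e i"
    and jump: "4 * d \<le> \<bar>\<nu> - \<nu>'\<bar>"
    and missed: "\<And>i. i \<in> {p - m<..p + m - 1} \<Longrightarrow> b i = 0"
  shows "\<exists>I\<in>{{p - m..p - 1}, {p..p + m - 1}}. \<exists>(A, q)\<in>{({..<d}, \<tau>), ({-d..}, 1 - \<tau>)}.
    (\<Sum>i\<in>I. of_bool (e i \<in> A) - q) \<le> 2 * real n * lam"
proof -
  define c where "c = design_mult n b (p - m)"
  have fit: "design_mult n b i = c" if "i \<in> {p - m..p + m - 1}" for i
    unfolding c_def using that m missed by (intro design_mult_constant) auto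
  consider "2 * d \<le> \<bar>c - \<nu>\<bar>" | "2 * d \<le> \<bar>c - \<nu>'\<bar>"
    using jump by linarith
  thus ?thesis
  proof cases
    case 1
    have "(\<Sum>i=p - m..p - 1. of_bool (e i \<in> {..<d}) - \<tau>) \<le> 2 * real n * lam
       \<or> (\<Sum>i=p - m..p - 1. of_bool (e i \<in> {-d..}) - (1 - \<tau>)) \<le> 2 * real n * lam"
      using m by (intro badly_fitted_block[OF opt lam d _ _ _ left _ 1] fit) auto
    thus ?thesis by auto
  next
    case 2
    have "(\<Sum>i=p..p + m - 1. of_bool (e i \<in> {..<d}) - \<tau>) \<le> 2 * real n * lam
       \<or> (\<Sum>i=p..p + m - 1. of_bool (e i \<in> {-d..}) - (1 - \<tau>)) \<le> 2 * real n * lam"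
      using m by (intro badly_fitted_block[OF opt lam d _ _ _ right _ 2] fit) auto
    thus ?thesis by auto
  qed
qed

lemma one_sided_dist_le:
  assumes "\<And>b. b \<in> B \<Longrightarrow> \<exists>a\<in>A. \<bar>real a - real b\<bar> \<le> x"
  shows "one_sided_dist A B \<le> ereal x"
  unfolding one_sided_dist_def
proof (rule SUP_least)
  fix b assume "b \<in> B"
  with assms obtain a where "a \<in> A" "\<bar>real a - real b\<bar> \<le> x" by blast
  thus "(INF a\<in>A. ereal \<bar>real a - real b\<bar>) \<le> ereal x"
    by (intro INF_lower2[of a]) auto
qed

lemma change_points_bounds:
  assumes "change_points n K t" "k \<in> {1..K}"
  shows "t 1 \<le> t k" "t (k + 1) \<le> n + 1"
proof -
  have mono: "t i \<le> t j" if "i \<in> {1..K}" "j \<in> {1..K}" "i \<le> j" for i j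
    using assms that strict_mono_on_leD unfolding change_points_def by blast
  show "t 1 \<le> t k" using assms by (intro mono) auto
  show "t (k + 1) \<le> n + 1"
  proof (cases "k = K")
    case False
    hence "t (k + 1) \<le> t K" using assms by (intro mono) auto
    thus ?thesis using assms by (simp add: change_points_def)
  qed (use assms in \<open>simp add: change_points_def\<close>)
qed

lemma min_gap_le:
  assumes "h \<le> min_gap K t" "k \<in> {1..K}"
  shows "h \<le> real (t (k + 1)) - real (t k)"
proof -
  have "min_gap K t \<le> real (t (k + 1)) - real (t k)"
    unfolding min_gap_def using assms(2) by (intro Min_le) auto
  with assms show ?thesis by simp
qed

text \<open>
  The blocks on either side of \<open>t k\<close> must lie inside a single phase.  The minimal gap guarantees
  this, except to the left of the first change-point, whose phase \<open>min_gap\<close> does not control and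
  which therefore needs a hypothesis of its own.
\<close>

lemma undetected_change_point:
  fixes y e b :: "nat \<Rightarrow> real"
  assumes cps: "change_points n K t" and model: "piecewise_constant_model K t \<mu> e y"
    and opt: "is_qlasso \<tau> n lam y b" and lam: "lam \<ge> 0" and d: "d > 0"
    and jumps: "\<And>k. k \<in> {1..K} \<Longrightarrow> 4 * d \<le> \<bar>\<mu> k - \<mu> (k + 1)\<bar>"
    and gap: "h \<le> min_gap K t" and first: "h < real (t 1)"
    and m: "1 \<le> m" "real m \<le> h"
    and far: "\<not> one_sided_dist (estimated_cps n b) (t ` {1..K}) \<le> ereal h"
  shows "\<exists>k\<in>{1..K}. \<exists>I\<in>{{t k - m..t k - 1}, {t k..t k + m - 1}}.
    \<exists>(A, q)\<in>{({..<d}, \<tau>), ({-d..}, 1 - \<tau>)}.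
      (\<Sum>i\<in>I. of_bool (e i \<in> A) - q) \<le> 2 * real n * lam"
proof -
  have "\<exists>k\<in>{1..K}. \<forall>a\<in>estimated_cps n b. \<not> \<bar>real a - real (t k)\<bar> \<le> h"
  proof (rule ccontr)
    assume "\<not> ?thesis"
    hence "one_sided_dist (estimated_cps n b) (t ` {1..K}) \<le> ereal h"
      by (intro one_sided_dist_le) blast
    with far show False by simp
  qed
  then obtain k where k: "k \<in> {1..K}"
    and missed: "\<And>a. a \<in> estimated_cps n b \<Longrightarrow> h < \<bar>real a - real (t k)\<bar>"
    by (auto simp: not_le)
  have y: "y i = \<mu> j + e i" if "j \<in> {1..K + 1}" "i \<in> {t (j - 1)..t j - 1}" for i j
    using model that unfolding piecewise_constant_model_def by blast
  have after: "t k + m \<le> t (k + 1)"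
    using min_gap_le[OF gap k] m by linarith
  have before: "t (k - 1) + m \<le> t k"
  proof (cases "k = 1")
    case True
    moreover have "t 0 = 1" using cps by (simp add: change_points_def)
    ultimately show ?thesis using first m by simp
  next
    case False
    with k have "k - 1 \<in> {1..K}" "k - 1 + 1 = k" by auto
    with min_gap_le[OF gap, of "k - 1"] m show ?thesis by simp
  qed
  note bounds = change_points_bounds[OF cps k]
  have "m < t k" using first m bounds by linarith
  moreover have "t k + m \<le> n + 1" using after bounds by linarith
  moreover have "y i = \<mu> k + e i" if "i \<in> {t k - m..t k - 1}" for i
    using that before k by (intro y) auto
  moreover have "y i = \<mu> (k + 1) + e i" if "i \<in> {t k..t k + m - 1}" for i
    using that after k m by (intro y) auto
  moreover have "b i = 0" if i: "i \<in> {t k - m<..t k + m - 1}" for i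
  proof (rule ccontr)
    assume "b i \<noteq> 0"
    hence "i \<in> estimated_cps n b"
      using i \<open>m < t k\<close> \<open>t k + m \<le> n + 1\<close> by (auto simp: estimated_cps_def)
    from missed[OF this] show False using i m by (auto simp: abs_if split: if_splits)
  qed
  ultimately show ?thesis
    using missed_jump[OF opt lam d m(1), of "t k" "\<mu> k" e "\<mu> (k + 1)"] jumps[OF k] k by blast
qed

section \<open>The error law and the events of the estimator\<close>

lemma density_interval_pos:
  fixes f :: "real \<Rightarrow> real"
  assumes [measurable]: "f \<in> borel_measurable borel" and f: "\<And>x. f x > 0" and "a < b"
  shows "emeasure (density lborel (\<lambda>x. ennreal (f x))) {a..<b} > 0"
proof (rule ccontr)
  assume "\<not> ?thesis"
  hence "{a..<b} \<in> null_sets (density lborel (\<lambda>x. ennreal (f x)))"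
    by (intro null_setsI) auto
  hence "AE x in lborel. x \<in> {a..<b} \<longrightarrow> ennreal (f x) = 0"
    by (subst (asm) null_sets_density_iff) auto
  hence "AE x in lborel. x \<notin> {a..<b}"
    by eventually_elim (metis f ennreal_eq_0_iff not_le)
  hence "{a..<b} \<in> null_sets lborel"
    by (subst AE_iff_null_sets) auto
  thus False using \<open>a < b\<close> by (auto simp: null_sets_def)
qed
text \<open>
  Both inequalities are strict because a positive density charges \<open>{0..<d}\<close> and \<open>{-d..<0}\<close>.
\<close>

lemma quantile_margin:
  fixes f :: "real \<Rightarrow> real"
  defines "D \<equiv> density lborel (\<lambda>x. ennreal (f x))"
  assumes f[measurable]: "f \<in> borel_measurable borel" and pos: "\<And>x. f x > 0"
    and D: "prob_space D" and q: "measure D {..<0} = \<tau>" and d: "d > 0"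
  shows "measure D {..<d} > \<tau>" "measure D {-d..} > 1 - \<tau>"
proof -
  interpret D: prob_space D by (rule D)
  have [simp]: "sets D = sets borel" "space D = UNIV" by (simp_all add: D_def)
  have mass: "measure D {a..<b} > 0" if "a < b" for a b
    using density_interval_pos[OF f pos that]
    by (simp add: D.emeasure_eq_measure flip: D_def)
  have "measure D ({..<0} \<union> {0..<d}) = \<tau> + measure D {0..<d}"
    by (subst D.finite_measure_Union) (auto simp: q)
  also have "{..<0} \<union> {0..<d} = {..<d}" using d by auto
  finally show "measure D {..<d} > \<tau>" using mass[of 0 d] d by simp
  have "measure D ({-d..<0} \<union> {0..}) = measure D {-d..<0} + measure D {0..}"
    by (subst D.finite_measure_Union) auto
  also have "{-d..<0} \<union> {0..} = {-d..}" using d by auto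
  also have "{0..} = space D - {..<0::real}" by auto
  also have "measure D \<dots> = 1 - \<tau>" by (subst D.prob_compl) (auto simp: q)
  finally show "measure D {-d..} > 1 - \<tau>" using mass[of "-d" 0] d by simp
qed

text \<open>
  There are only finitely many possible sets of estimated change-points, so the property \<open>P\<close> may be
  arbitrary.
\<close>

lemma estimated_cps_event_measurable:
  assumes [measurable]: "\<beta> \<in> M \<rightarrow>\<^sub>M (\<Pi>\<^sub>M i\<in>{1..n}. borel)"
  shows "{\<omega> \<in> space M. P (estimated_cps n (\<beta> \<omega>))} \<in> sets M"
proof -
  have [measurable]: "(\<lambda>\<omega>. \<beta> \<omega> i) \<in> borel_measurable M" if "i \<in> {2..n}" for i
    using that by (intro measurable_compose[OF assms] measurable_component_singleton) auto
  have support: "estimated_cps n b = S \<longleftrightarrow> (\<forall>i\<in>{2..n}. b i \<noteq> 0 \<longleftrightarrow> i \<in> S)"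
    if "S \<subseteq> {2..n}" for S b
    using that by (auto simp: estimated_cps_def)
  have "{\<omega> \<in> space M. P (estimated_cps n (\<beta> \<omega>))}
      = (\<Union>S\<in>{S \<in> Pow {2..n}. P S}. {\<omega> \<in> space M. estimated_cps n (\<beta> \<omega>) = S})"
    by (auto simp: estimated_cps_def)
  also have "\<dots> = (\<Union>S\<in>{S \<in> Pow {2..n}. P S}. {\<omega> \<in> space M. \<forall>i\<in>{2..n}. \<beta> \<omega> i \<noteq> 0 \<longleftrightarrow> i \<in> S})"
    by (intro SUP_cong refl Collect_cong conj_cong support) auto
  also have "\<dots> \<in> sets M"
    by (intro sets.finite_UN) measurable
  finally show ?thesis .
qed

section \<open>Asymptotics of the block length\<close>

text \<open>
  Eventually \<open>\<delta> n \<ge> lam n\<close>, so \<open>n \<delta>\<^sub>n\<close> dominates \<open>n \<lambda>\<^sub>n = C sqrt (n ln n)\<close> and tends to infinity.  Once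
  \<open>n \<delta>\<^sub>n \<ge> 2\<close>, rounding down loses at most half of it, which turns \<open>\<lambda>\<^sub>n \<le> (\<gamma> / 4) \<delta>\<^sub>n\<close> into the second
  claim.
\<close>

lemma penalty_below_gap:
  fixes lam \<delta> :: "nat \<Rightarrow> real"
  assumes C: "C > 0" and lam: "\<And>n. n \<ge> n0 \<Longrightarrow> lam n = C * sqrt (ln (real n) / real n)"
    and lam_pos: "\<And>n. n \<ge> n0 \<Longrightarrow> lam n > 0"
    and pos: "\<And>n. \<delta> n > 0" and lim: "(\<lambda>n. lam n / \<delta> n) \<longlonglongrightarrow> 0" and "\<gamma> > 0"
  shows "filterlim (\<lambda>n. nat \<lfloor>real n * \<delta> n\<rfloor>) at_top sequentially"
    and "eventually (\<lambda>n. 2 * real n * lam n \<le> \<gamma> * real (nat \<lfloor>real n * \<delta> n\<rfloor>)) sequentially"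
proof -
  have ratio: "eventually (\<lambda>n. lam n \<le> c * \<delta> n) sequentially" if "c > 0" for c
    using order_tendstoD(2)[OF lim that] by eventually_elim (use pos in \<open>simp add: field_simps less_imp_le\<close>)
  have "filterlim (\<lambda>n. C * sqrt (ln (real n) * real n)) at_top sequentially"
    using C by real_asymp
  moreover have "eventually (\<lambda>n. C * sqrt (ln (real n) * real n) \<le> real n * \<delta> n) sequentially"
    using ratio[OF zero_less_one] eventually_ge_at_top[of n0] eventually_gt_at_top[of 0]
  proof eventually_elim
    case (elim n)
    have "real n * sqrt (ln (real n) / real n) = sqrt ((real n)\<^sup>2 * (ln (real n) / real n))"
      by (simp only: real_sqrt_mult real_sqrt_abs abs_of_nat)
    also have "(real n)\<^sup>2 * (ln (real n) / real n) = ln (real n) * real n"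
      using elim by (simp add: power2_eq_square)
    finally have "real n * sqrt (ln (real n) / real n) = sqrt (ln (real n) * real n)" .
    hence "C * sqrt (ln (real n) * real n) = real n * lam n"
      using elim by (simp add: lam)
    also have "\<dots> \<le> real n * \<delta> n" using elim by (intro mult_left_mono) auto
    finally show ?case .
  qed
  ultimately have window: "filterlim (\<lambda>n. real n * \<delta> n) at_top sequentially"
    by (rule filterlim_at_top_mono)
  show "filterlim (\<lambda>n. nat \<lfloor>real n * \<delta> n\<rfloor>) at_top sequentially"
    by (intro filterlim_compose[OF filterlim_nat_sequentially] filterlim_compose[OF filterlim_floor_sequentially] window)
  have "\<gamma> / 4 > 0" using \<open>\<gamma> > 0\<close> by simp
  from ratio[OF this] filterlim_at_top[THEN iffD1, OF window, rule_format, of 2]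
  show "eventually (\<lambda>n. 2 * real n * lam n \<le> \<gamma> * real (nat \<lfloor>real n * \<delta> n\<rfloor>)) sequentially"
  proof eventually_elim
    case (elim n)
    have "real n * lam n \<le> real n * (\<gamma> / 4 * \<delta> n)"
      using elim by (intro mult_left_mono) auto
    hence "2 * real n * lam n \<le> \<gamma> * (real n * \<delta> n / 2)" by (simp add: algebra_simps)
    also have "\<dots> \<le> \<gamma> * real (nat \<lfloor>real n * \<delta> n\<rfloor>)"
      using elim \<open>\<gamma> > 0\<close> by (intro mult_left_mono) linarith+
    finally show ?case .
  qed
qed
section \<open>Consistency of the estimated change-points\<close>

theorem theorem3p2:
  fixes \<tau> C :: real
    and M :: "nat \<Rightarrow> 'a measure"
    and \<epsilon> Y :: "nat \<Rightarrow> nat \<Rightarrow> 'a \<Rightarrow> real"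
    and \<beta> :: "nat \<Rightarrow> 'a \<Rightarrow> nat \<Rightarrow> real"
    and t :: "nat \<Rightarrow> nat \<Rightarrow> nat"
    and \<mu> \<tau>s :: "nat \<Rightarrow> real"
    and \<delta> lam :: "nat \<Rightarrow> real"
    and F f :: "real \<Rightarrow> real"
    and K n0 :: nat
  assumes tau: "0 < \<tau>" "\<tau> < 1"
    and prob: "\<And>n. n \<ge> n0 \<Longrightarrow> prob_space (M n)"
    and K: "1 \<le> K"
    and cps: "\<And>n. n \<ge> n0 \<Longrightarrow> change_points n K (t n)"
    and jumps: "\<And>k. k \<in> {1..K} \<Longrightarrow> \<mu> k \<noteq> \<mu> (k + 1)"
    and model: "\<And>n \<omega>. n \<ge> n0 \<Longrightarrow> \<omega> \<in> space (M n) \<Longrightarrow>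
        piecewise_constant_model K (t n) \<mu> (\<lambda>i. \<epsilon> n i \<omega>) (\<lambda>i. Y n i \<omega>)"
    and lam_pos: "\<And>n. n \<ge> n0 \<Longrightarrow> lam n > 0"
    and beta_random: "\<And>n. n \<ge> n0 \<Longrightarrow> \<beta> n \<in> M n \<rightarrow>\<^sub>M (\<Pi>\<^sub>M i\<in>{1..n}. borel)"
    and beta_lasso: "\<And>n \<omega>. n \<ge> n0 \<Longrightarrow> \<omega> \<in> space (M n) \<Longrightarrow>
        is_qlasso \<tau> n (lam n) (\<lambda>i. Y n i \<omega>) (\<beta> n \<omega>)"
    and err_indep: "\<And>n. n \<ge> n0 \<Longrightarrow> prob_space.indep_vars (M n) (\<lambda>_. borel) (\<epsilon> n) {1..n}"
    and err_cdf: "\<And>n i. n \<ge> n0 \<Longrightarrow> i \<in> {1..n} \<Longrightarrow> cdf (distr (M n) borel (\<epsilon> n i)) = F"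
    and err_density: "\<And>n i. n \<ge> n0 \<Longrightarrow> i \<in> {1..n} \<Longrightarrow>
        distributed (M n) lborel (\<epsilon> n i) (\<lambda>x. ennreal (f x))"
    and err_quantile: "\<And>n i. n \<ge> n0 \<Longrightarrow> i \<in> {1..n} \<Longrightarrow>
        measure (M n) {\<omega> \<in> space (M n). \<epsilon> n i \<omega> < 0} = \<tau>"
    and f_pos: "\<And>x. f x > 0"
    and f_C1: "f C1_differentiable_on UNIV"
    and delta_pos: "\<And>n. \<delta> n > 0"
    and delta_decreasing: "decseq \<delta>"
    and delta_lim: "\<delta> \<longlonglongrightarrow> 0"
    and gap: "\<And>n. n \<ge> n0 \<Longrightarrow> min_gap K (t n) \<ge> real n * \<delta> n"
    and lam_delta: "(\<lambda>n. lam n / \<delta> n) \<longlonglongrightarrow> 0"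
    and C_pos: "C > 0"
    and lam_def: "\<And>n. n \<ge> n0 \<Longrightarrow> lam n = C * sqrt (ln (real n) / real n)"
    and cps_lim: "\<And>k. k \<in> {1..K} \<Longrightarrow> (\<lambda>n. real (t n k) / real n) \<longlonglongrightarrow> \<tau>s k"
    and fractions: "\<And>k. k \<in> {1..K} \<Longrightarrow> 0 < \<tau>s k \<and> \<tau>s k < 1" "strict_mono_on {1..K} \<tau>s"
    and enough: "(\<lambda>n. measure (M n)
        {\<omega> \<in> space (M n). K \<le> card (estimated_cps n (\<beta> n \<omega>))}) \<longlonglongrightarrow> 1"
  shows "(\<lambda>n. measure (M n)
        {\<omega> \<in> space (M n).
           one_sided_dist (estimated_cps n (\<beta> n \<omega>)) (t n ` {1..K}) \<le> ereal (real n * \<delta> n)})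
      \<longlonglongrightarrow> 1"
proof -
  define d where "d = Min ((\<lambda>k. \<bar>\<mu> k - \<mu> (k + 1)\<bar> / 4) ` {1..K})"
  have d: "d > 0"
    unfolding d_def using K jumps by (subst Min_gr_iff) auto
  have jump_size: "4 * d \<le> \<bar>\<mu> k - \<mu> (k + 1)\<bar>" if "k \<in> {1..K}" for k
  proof -
    have "d \<le> \<bar>\<mu> k - \<mu> (k + 1)\<bar> / 4" unfolding d_def using that by (intro Min_le) auto
    thus ?thesis by simp
  qed

  define D where "D = density lborel (\<lambda>x. ennreal (f x))"
  have law: "measure (M n) {\<omega> \<in> space (M n). \<epsilon> n i \<omega> \<in> A} = measure D A"
    if "n \<ge> n0" "i \<in> {1..n}" "A \<in> sets borel" for n i A
  proof -
    have "D = distr (M n) lborel (\<epsilon> n i)"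
      using err_density[OF that(1,2)] by (simp add: D_def distributed_def)
    moreover have "\<epsilon> n i \<in> M n \<rightarrow>\<^sub>M lborel"
      using err_density[OF that(1,2)] by (rule distributed_measurable)
    ultimately show ?thesis
      using that(3) by (simp add: measure_distr vimage_def Int_def conj_commute)
  qed
  \<comment> \<open>Any single error shows that \<open>D\<close>, the common law of all errors, is a probability measure
    that gives the negative half-line mass \<open>\<tau>\<close>.\<close>
  define N where "N = max n0 1"
  have N: "N \<ge> n0" "1 \<in> {1..N}" by (auto simp: N_def)
  note dens = err_density[OF N]
  have f: "f \<in> borel_measurable borel"
    using distributed_real_measurable[OF _ dens] f_pos by (simp add: less_imp_le)
  have D: "prob_space D"
    using prob_space.prob_space_distr[OF prob[OF N(1)] distributed_measurable[OF dens]] dens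
    by (simp add: D_def distributed_def)
  have D0: "measure D {..<0} = \<tau>"
    using law[OF N, of "{..<0}"] err_quantile[OF N] by simp
  note margin = quantile_margin[OF f f_pos D[unfolded D_def] D0[unfolded D_def] d, folded D_def]
  define \<gamma> where "\<gamma> = min (measure D {..<d} - \<tau>) (measure D {-d..} - (1 - \<tau>)) / 2"
  have \<gamma>: "\<gamma> > 0" using margin by (simp add: \<gamma>_def)
  \<comment> \<open>A pair in \<open>H\<close> is a half-line and the share of errors in it that optimality of the fit
    around an undetected change-point cannot noticeably exceed;
    an index in \<open>J n\<close> selects a change-point, one of its two blocks, and such a pair.\<close>
  define H where "H = {({..<d}, \<tau>), ({-d..}, 1 - \<tau>)}"
  have H: "A \<in> sets borel" "q + 2 * \<gamma> \<le> measure D A" if "(A, q) \<in> H" for A q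
    using that by (auto simp: H_def \<gamma>_def)

  define m where "m n = nat \<lfloor>real n * \<delta> n\<rfloor>" for n
  define Is where "Is n k = {{t n k - m n..t n k - 1}, {t n k..t n k + m n - 1}}" for n k
  define J where "J n = (SIGMA k:{1..K}. Is n k \<times> H)" for n
  define bad where "bad n = (\<lambda>(k :: nat, I, A, q :: real). {\<omega> \<in> space (M n).
      (\<Sum>i\<in>I. of_bool (\<epsilon> n i \<omega> \<in> A)) \<le> real (card I) * (measure D A - \<gamma>)})" for n
  define good where "good n = {\<omega> \<in> space (M n).
      one_sided_dist (estimated_cps n (\<beta> n \<omega>)) (t n ` {1..K}) \<le> ereal (real n * \<delta> n)}" for n

  have window: "filterlim m at_top sequentially"
    unfolding m_def by (rule penalty_below_gap(1)[OF C_pos _ _ delta_pos lam_delta \<gamma>]) (fact lam_def lam_pos)+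
  have penalty: "eventually (\<lambda>n. 2 * real n * lam n \<le> \<gamma> * real (m n)) sequentially"
    unfolding m_def by (rule penalty_below_gap(2)[OF C_pos _ _ delta_pos lam_delta \<gamma>]) (fact lam_def lam_pos)+
  \<comment> \<open>The limit \<open>\<tau>s 1\<close> of \<open>t n 1 / n\<close> is positive, while \<open>\<delta>\<close> tends to \<open>0\<close>.\<close>
  have first: "eventually (\<lambda>n. real n * \<delta> n < real (t n 1)) sequentially"
  proof -
    have "(\<lambda>n. real (t n 1) / real n - \<delta> n) \<longlonglongrightarrow> \<tau>s 1 - 0"
      using K by (intro tendsto_diff cps_lim delta_lim) auto
    moreover have "\<tau>s 1 > 0" using fractions(1)[of 1] K by simp
    ultimately have "eventually (\<lambda>n. 0 < real (t n 1) / real n - \<delta> n) sequentially"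
      by (intro order_tendstoD(1)) auto
    with eventually_gt_at_top[of 0] show ?thesis
      by eventually_elim (simp add: field_simps)
  qed
  have nonempty: "eventually (\<lambda>n. 1 \<le> m n) sequentially"
    using window by (auto simp: filterlim_at_top)
  have bound: "eventually (\<lambda>n. 1 - real K * 4 * exp (- 2 * \<gamma>\<^sup>2 * real (m n)) \<le> measure (M n) (good n))
      sequentially"
    using eventually_ge_at_top[of n0] nonempty penalty first
  proof eventually_elim
    case (elim n)
    note n = \<open>n \<ge> n0\<close> and m = \<open>1 \<le> m n\<close>
    interpret prob_space "M n" by (rule prob[OF n])
    note bounds = change_points_bounds[OF cps[OF n]]
    have mh: "real (m n) \<le> real n * \<delta> n" using m by (simp add: m_def) linarith
    have block: "I \<subseteq> {1..n}" "card I = m n" if "k \<in> {1..K}" "I \<in> Is n k" for k I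
    proof -
      have "real n * \<delta> n \<le> real (t n (k + 1)) - real (t n k)"
        by (rule min_gap_le[OF gap[OF n] that(1)])
      hence "t n k + m n \<le> n + 1" using mh bounds[OF that(1)] by linarith
      moreover have "m n < t n k" using mh bounds[OF that(1)] elim by linarith
      ultimately show "I \<subseteq> {1..n}" "card I = m n"
        using that m by (auto simp: Is_def)
    qed
    have e[measurable]: "\<epsilon> n i \<in> borel_measurable (M n)" if "i \<in> {1..n}" for i
      using err_indep[OF n] that unfolding indep_vars_def by blast
    have bad_sets: "bad n x \<in> events" if x: "x \<in> J n" for x
    proof -
      obtain k I A q where [simp]: "x = (k, I, A, q)" by (cases x) auto
      have [measurable]: "A \<in> sets borel" using x H by (auto simp: J_def)
      have [measurable]: "\<epsilon> n i \<in> borel_measurable (M n)" if "i \<in> I" for i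
        using that x block e by (fastforce simp: J_def)
      have "(\<lambda>\<omega>. \<Sum>i\<in>I. of_bool (\<epsilon> n i \<omega> \<in> A) :: real) \<in> borel_measurable (M n)"
        by (intro borel_measurable_sum) (simp add: of_bool_def)
      thus ?thesis by (simp add: bad_def)
    qed
    have bad_prob: "prob (bad n x) \<le> exp (- 2 * \<gamma>\<^sup>2 * real (m n))" if x: "x \<in> J n" for x
    proof -
      obtain k I A q where [simp]: "x = (k, I, A, q)" by (cases x) auto
      have I: "I \<subseteq> {1..n}" "card I = m n" and A: "A \<in> sets borel"
        using x block[of k I] H by (auto simp: J_def)
      have "finite I" "I \<noteq> {}" using I m by (auto simp: finite_subset)
      thus ?thesis
        using count_lower_deviation[of "\<epsilon> n" I A "measure D A" \<gamma>] I A law[OF n] \<gamma>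
          indep_vars_subset[OF err_indep[OF n] I(1)]
        by (simp add: bad_def subset_iff)
    qed
    have cover: "space (M n) - good n \<subseteq> (\<Union>x\<in>J n. bad n x)"
    proof
      fix \<omega> assume \<omega>: "\<omega> \<in> space (M n) - good n"
      have "\<exists>k\<in>{1..K}. \<exists>I\<in>Is n k. \<exists>(A, q)\<in>H.
          (\<Sum>i\<in>I. of_bool (\<epsilon> n i \<omega> \<in> A) - q) \<le> 2 * real n * lam n"
        unfolding Is_def H_def
        using \<omega> elim lam_pos[OF n] jump_size mh
        by (intro undetected_change_point[OF cps[OF n] model[OF n] beta_lasso[OF n] _ d _ gap[OF n]])
           (auto simp: good_def)
      then obtain k I A q where x: "k \<in> {1..K}" "I \<in> Is n k" "(A, q) \<in> H"
        and low: "(\<Sum>i\<in>I. of_bool (\<epsilon> n i \<omega> \<in> A) - q) \<le> 2 * real n * lam n"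
        by blast
      have "(\<Sum>i\<in>I. of_bool (\<epsilon> n i \<omega> \<in> A)) \<le> real (card I) * q + real (card I) * \<gamma>"
        using low elim block[OF x(1,2)] by (simp add: sum_subtractf mult.commute)
      also have "\<dots> = real (card I) * (q + \<gamma>)" by (simp add: distrib_left)
      also have "\<dots> \<le> real (card I) * (measure D A - \<gamma>)"
        using H(2)[OF x(3)] by (intro mult_left_mono) auto
      finally have "\<omega> \<in> bad n (k, I, A, q)" using \<omega> by (simp add: bad_def)
      moreover have "(k, I, A, q) \<in> J n" using x by (simp add: J_def)
      ultimately show "\<omega> \<in> (\<Union>x\<in>J n. bad n x)" by blast
    qed
    have card2: "card {a, b} \<le> 2" for a b :: 'z by (simp add: card_insert_if)
    have finite_Is: "finite (Is n k)" and finite_H: "finite H" for k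
      by (simp_all add: Is_def H_def)
    have finite_J: "finite (J n)"
      unfolding J_def using finite_Is finite_H by blast
    have "card (J n) = (\<Sum>k=1..K. card (Is n k) * card H)"
      unfolding J_def using finite_Is finite_H by (simp add: card_cartesian_product)
    also have "\<dots> \<le> (\<Sum>k=1..K. 2 * 2)"
      unfolding Is_def H_def by (intro sum_mono mult_le_mono card2)
    finally have card_J: "card (J n) \<le> K * 4" by simp
    have good_sets: "good n \<in> events"
      unfolding good_def by (rule estimated_cps_event_measurable[OF beta_random[OF n]])
    hence "1 - prob (good n) = prob (space (M n) - good n)"
      by (simp add: prob_compl)
    also have "\<dots> \<le> prob (\<Union>x\<in>J n. bad n x)"
      using cover bad_sets finite_J by (intro finite_measure_mono sets.finite_UN) auto
    also have "\<dots> \<le> (\<Sum>x\<in>J n. prob (bad n x))"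
      using bad_sets finite_J by (intro measure_UNION_le) auto
    also have "\<dots> \<le> real (card (J n)) * exp (- 2 * \<gamma>\<^sup>2 * real (m n))"
      using bad_prob by (rule sum_bounded_above)
    also have "\<dots> \<le> real (K * 4) * exp (- 2 * \<gamma>\<^sup>2 * real (m n))"
      using card_J by (intro mult_right_mono of_nat_mono) auto
    finally show ?case by simp
  qed
  have "filterlim (\<lambda>n. real (m n)) at_top sequentially"
    using window by (rule filterlim_compose[OF filterlim_real_sequentially])
  hence "(\<lambda>n. exp (- 2 * \<gamma>\<^sup>2 * real (m n))) \<longlonglongrightarrow> 0"
    using \<gamma> by (intro filterlim_compose[OF exp_at_bot] filterlim_tendsto_neg_mult_at_bot[OF tendsto_const]) auto
  hence "(\<lambda>n. 1 - real K * 4 * exp (- 2 * \<gamma>\<^sup>2 * real (m n))) \<longlonglongrightarrow> 1 - real K * 4 * 0"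
    by (intro tendsto_intros)
  hence "(\<lambda>n. 1 - real K * 4 * exp (- 2 * \<gamma>\<^sup>2 * real (m n))) \<longlonglongrightarrow> 1" by simp
  moreover have "eventually (\<lambda>n. measure (M n) (good n) \<le> 1) sequentially"
    using eventually_ge_at_top[of n0] by eventually_elim (rule prob_space.prob_le_1[OF prob])
  ultimately have "(\<lambda>n. measure (M n) (good n)) \<longlonglongrightarrow> 1"
    using bound by (intro tendsto_sandwich[OF bound _ _ tendsto_const])
  thus ?thesis by (simp add: good_def)
qed

end
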